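(* Let $H$ be differentiable, let $V_*\in\mathbb{U}^{n\times k}$ be a solution of the NEPv $H(V)V=V\Lambda$ with $\delta_*:=\lambda_{k+1}(H(V_* ))-\lambda_k(H(V_* ))>0$, and suppose that the $\mathbb{R}$-linear operator $\mathscr{Q}:\mathbb{C}^{(n-k)\times k}\to\mathbb{C}^{(n-k)\times k}$, $$\mathscr{Q}(Z)=V_{*\perp}^{H}\,\mathbf{D}H(V_* )[V_{*\perp}Z]\,V_*+\Lambda_{*\perp}Z-Z\Lambda_*,$$ is self-adjoint and positive definite with respect to the inner product $\langle X,Y\rangle=\mathrm{Re}\,\mathrm{tr}(X^HY)$. Let $\sigma\in(-\delta_*,+\infty)$, $H_\sigma(V):=H(V)-\sigma VV^H$, and let $$\mathcal{L}_\sigma(Z)=D_\sigma(V_* )\odot\big(V_{*\perp}^{H}\,\mathbf{D}H_\sigma(V_* )[V_{*\perp}Z]\,V_*\big)$$ be the local $\mathbb{R}$-linear operator of the level-shifted SCF. Then $$\mathcal{L}_\sigma(\cdot)=D_\sigma(V_* )\odot\mathscr{Q}(\cdot)-I_{\mathrm{id}},$$ where $I_{\mathrm{id}}$ is the identity operator on $\mathbb{C}^{(n-k)\times k}$ (as a real vector space). Moreover, $$\rho(\mathcal{L}_\sigma)\le\max\left\{\left|\frac{\mu_{\max}}{\sigma+\delta_*}-1\right|,\ \left|\frac{\mu_{\min}}{\sigma+s_*}-1\right|\right\},$$ where $\mu_{\max}\ge\mu_{\min}>0$ are the largest and smallest eigenvalues of the $\mathbb{R}$-linear operator $\mathscr{Q}$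 and $s_*:=\lambda_n(H(V_* ))-\lambda_1(H(V_* ))$.
   Context: $\mathbb{U}^{n\times k}$ is the set of $n\times k$ complex matrices $V$ with $V^HV=I_k$ ($^H$ is conjugate transpose). $H:\mathbb{C}^{n\times k}\to\mathbb{C}^{n\times n}$ is a continuous Hermitian-matrix-valued function with $H(VQ)=H(V)$ for every $k\times k$ unitary $Q$. $\lambda_1(M)\le\dots\le\lambda_n(M)$ denote eigenvalues in ascending order. A solution of the NEPv is $V_*\in\mathbb{U}^{n\times k}$ with $H(V_* )V_*=V_*\Lambda_*$, where the eigenvalues of $\Lambda_*$ are the $k$ smallest eigenvalues of $H(V_* )$. Fix $H(V_* )[V_*,V_{*\perp}]=[V_*,V_{*\perp}]\,\mathrm{diag}(\Lambda_*,\Lambda_{*\perp})$ with $[V_*,V_{*\perp}]$ unitary, $\Lambda_*=\mathrm{diag}(\lambda_1,\dots,\lambda_k)$, $\Lambda_{*\perp}=\mathrm{diag}(\lambda_{k+1},\dots,\lambda_n)$, $\lambda_i=\lambda_i(H(V_* ))$. $H$ is differentiable if each entry of $H(V)$ is a smooth function of the real and imaginary parts of $V$; $\mathbf{D}H(V_* )[X]=\frac{d}{dt}H(V_*+tX)|_{t=0}$ ($t\in\mathbb{R}$), which is $\mathbb{R}$-linear in $X$. $\mathbf{D}H_\sigma(V_* )$ is defined likewise for $H_\sigma$. $D_\sigma(V_* )\in\mathbb{R}^{(n-k)\times k}$ has entries $D_\sigma(V_* )_{ij}=(\lambda_{k+i}-\lambda_j+\sigma)^{-1}$, and $\odot$ is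 the entrywise product. The level-shifted SCF is $[H(V_i)-\sigma V_iV_i^H]V_{i+1}=V_{i+1}\Lambda_{i+1}$, with $V_{i+1}\in\mathbb{U}^{n\times k}$ a basis of the invariant subspace for the $k$ smallest eigenvalues of $H(V_i)-\sigma V_iV_i^H$. For an $\mathbb{R}$-linear operator (additive and homogeneous over real scalars) on $\mathbb{C}^{(n-k)\times k}$, eigenvalues and the spectral radius $\rho$ (largest modulus of the complex eigenvalues) are those of a real $2(n-k)k\times2(n-k)k$ matrix representing it on $\mathbb{C}^{(n-k)\times k}$ viewed as a real vector space. Self-adjoint and positive definite means $\mathrm{Re}\,\mathrm{tr}(Y^H\mathscr{Q}(Z))=\mathrm{Re}\,\mathrm{tr}([\mathscr{Q}(Y)]^HZ)$ for all $Y,Z$, and $\mathrm{Re}\,\mathrm{tr}(Z^H\mathscr{Q}(Z))>0$ for all $Z\ne0$. *)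

theory Defs
  imports
    "HOL-Analysis.Analysis"
    "HOL-Computational_Algebra.Fundamental_Theorem_Algebra"
    "Jordan_Normal_Form.Spectral_Radius"
begin

no_notation Matrix.vec_index (infixl \<open>$\<close> 100)

type_synonym ('r, 'c) cmat = "complex^'c^'r"
type_synonym ('r, 'c) rmat = "real^'c^'r"

text \<open>
  An \<open>r \<times> c\<close> complex matrix is an element of \<open>('r, 'c) cmat\<close>; its real and imaginary parts are
  the coordinates of this type as a Euclidean space over the reals.  Index types are finite and
  linearly ordered, so that rows and columns can be numbered \<open>1, 2, \<dots>\<close>.  The type \<open>'m\<close> always
  plays the role of an index set with \<open>n - k\<close> elements.
\<close>

definition pos :: "'i::{finite,linorder} \<Rightarrow> nat" where
  "pos i = card {..i}"

definition ctrans :: "complex^'c^'r \<Rightarrow> complex^'r^'c" where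
  "ctrans A = (\<chi> i j. cnj (A $ j $ i))"

definition hermitian :: "complex^'n^'n \<Rightarrow> bool" where
  "hermitian A \<longleftrightarrow> ctrans A = A"

definition stiefel :: "(complex^'k^'n) set" where
  "stiefel = {V. ctrans V ** V = Finite_Cartesian_Product.mat 1}"

text \<open>Row and column index types may differ, as for \<open>[V, W]\<close> below, so both products are required.\<close>

definition unitary :: "complex^'c^'r \<Rightarrow> bool" where
  "unitary U \<longleftrightarrow> ctrans U ** U = Finite_Cartesian_Product.mat 1
                \<and> U ** ctrans U = Finite_Cartesian_Product.mat 1"

definition hcat :: "'a^'k^'n \<Rightarrow> 'a^'m^'n \<Rightarrow> 'a^('k + 'm)^'n" where
  "hcat V W = (\<chi> i s. case s of Inl j \<Rightarrow> V $ i $ j | Inr j \<Rightarrow> W $ i $ j)"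

definition block_diag :: "'a::zero^'k^'k \<Rightarrow> 'a^'m^'m \<Rightarrow> 'a^('k + 'm)^('k + 'm)" where
  "block_diag A B = (\<chi> s t. case (s, t) of
      (Inl i, Inl j) \<Rightarrow> A $ i $ j
    | (Inr i, Inr j) \<Rightarrow> B $ i $ j
    | _ \<Rightarrow> 0)"

definition hadamard :: "real^'c^'r \<Rightarrow> complex^'c^'r \<Rightarrow> complex^'c^'r" where
  "hadamard D Z = (\<chi> i j. complex_of_real (D $ i $ j) * Z $ i $ j)"

definition to_mat :: "'a^'c::{finite,linorder}^'r::{finite,linorder} \<Rightarrow> 'a Matrix.mat" where
  "to_mat A = Matrix.mat CARD('r) CARD('c)
     (\<lambda>(i, j). A $ (sorted_list_of_set UNIV ! i) $ (sorted_list_of_set UNIV ! j))"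

definition eigvals_mset :: "('n::{finite,linorder}, 'n) cmat \<Rightarrow> complex multiset" where
  "eigvals_mset A = proots (char_poly (to_mat A))"

text \<open>
  \<open>lam A i\<close> is the \<open>i\<close>-th smallest eigenvalue (\<open>i = 1, \<dots>, n\<close>, with multiplicity) of a Hermitian
  matrix; all eigenvalues are then real.
\<close>

definition lam :: "('n::{finite,linorder}, 'n) cmat \<Rightarrow> nat \<Rightarrow> real" where
  "lam A i = sorted_list_of_multiset (image_mset Re (eigvals_mset A)) ! (i - 1)"

primrec k_smooth :: "nat \<Rightarrow> ('a::real_normed_vector \<Rightarrow> 'b::real_normed_vector) \<Rightarrow> bool" where
  "k_smooth 0 f \<longleftrightarrow> continuous_on UNIV f"
| "k_smooth (Suc r) f \<longleftrightarrow> (\<forall>x. f differentiable (at x))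
      \<and> (\<forall>v. k_smooth r (\<lambda>x. frechet_derivative f (at x) v))"

definition smooth :: "('a::real_normed_vector \<Rightarrow> 'b::real_normed_vector) \<Rightarrow> bool" where
  "smooth f \<longleftrightarrow> (\<forall>r. k_smooth r f)"

definition mat_differentiable :: "(complex^'k^'n \<Rightarrow> complex^'n^'n) \<Rightarrow> bool" where
  "mat_differentiable H \<longleftrightarrow> (\<forall>i j. smooth (\<lambda>V. H V $ i $ j))"

definition dir_deriv ::
  "(complex^'k^'n \<Rightarrow> complex^'n^'n) \<Rightarrow> complex^'k^'n \<Rightarrow> complex^'k^'n \<Rightarrow> complex^'n^'n" where
  "dir_deriv H V X = vector_derivative (\<lambda>t::real. H (V + t *\<^sub>R X)) (at 0)"

definition nepv_solution ::
  "(('n::{finite,linorder}, 'k::{finite,linorder}) cmat \<Rightarrow> ('n, 'n) cmat) \<Rightarrow> ('n, 'k) cmat \<Rightarrow> bool" where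
  "nepv_solution H V \<longleftrightarrow> V \<in> stiefel \<and>
     (\<exists>\<Lambda>. H V ** V = V ** \<Lambda> \<and>
       eigvals_mset \<Lambda> = image_mset (\<lambda>i. complex_of_real (lam (H V) i)) (mset_set {1..CARD('k)}))"

definition Lam ::
  "(('n::{finite,linorder}, 'k::{finite,linorder}) cmat \<Rightarrow> ('n, 'n) cmat) \<Rightarrow> ('n, 'k) cmat
    \<Rightarrow> ('k, 'k) cmat" where
  "Lam H V = (\<chi> i j. if i = j then complex_of_real (lam (H V) (pos j)) else 0)"

definition Lam_perp ::
  "(('n::{finite,linorder}, 'k::finite) cmat \<Rightarrow> ('n, 'n) cmat) \<Rightarrow> ('n, 'k) cmat
    \<Rightarrow> ('m, 'm::{finite,linorder}) cmat" where
  "Lam_perp H V = (\<chi> i j. if i = j then complex_of_real (lam (H V) (CARD('k) + pos j)) else 0)"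

definition D_sigma ::
  "(('n::{finite,linorder}, 'k::{finite,linorder}) cmat \<Rightarrow> ('n, 'n) cmat) \<Rightarrow> ('n, 'k) cmat
    \<Rightarrow> real \<Rightarrow> ('m::{finite,linorder}, 'k) rmat" where
  "D_sigma H V \<sigma> =
     (\<chi> i j. inverse (lam (H V) (CARD('k) + pos i) - lam (H V) (pos j) + \<sigma>))"

definition level_shift ::
  "real \<Rightarrow> (complex^'k^'n \<Rightarrow> complex^'n^'n) \<Rightarrow> complex^'k^'n \<Rightarrow> complex^'n^'n" where
  "level_shift \<sigma> H V = H V - \<sigma> *\<^sub>R (V ** ctrans V)"

text \<open>In the two operators, \<open>W\<close> stands for the orthonormal complement of \<open>V\<close>.\<close>

definition Q_op ::
  "(('n::{finite,linorder}, 'k::{finite,linorder}) cmat \<Rightarrow> ('n, 'n) cmat) \<Rightarrow> ('n, 'k) cmat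
    \<Rightarrow> ('n, 'm::{finite,linorder}) cmat \<Rightarrow> ('m, 'k) cmat \<Rightarrow> ('m, 'k) cmat" where
  "Q_op H V W Z =
     ctrans W ** dir_deriv H V (W ** Z) ** V + Lam_perp H V ** Z - Z ** Lam H V"

definition L_op ::
  "(('n::{finite,linorder}, 'k::{finite,linorder}) cmat \<Rightarrow> ('n, 'n) cmat) \<Rightarrow> ('n, 'k) cmat
    \<Rightarrow> ('n, 'm::{finite,linorder}) cmat \<Rightarrow> real \<Rightarrow> ('m, 'k) cmat \<Rightarrow> ('m, 'k) cmat" where
  "L_op H V W \<sigma> Z =
     hadamard (D_sigma H V \<sigma>) (ctrans W ** dir_deriv (level_shift \<sigma> H) V (W ** Z) ** V)"

definition real_inner_prod :: "complex^'c^'r \<Rightarrow> complex^'c^'r \<Rightarrow> real" where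
  "real_inner_prod X Y = Re (Determinants.trace (ctrans X ** Y))"

definition self_adjoint_op :: "(complex^'c^'r \<Rightarrow> complex^'c^'r) \<Rightarrow> bool" where
  "self_adjoint_op f \<longleftrightarrow> (\<forall>Y Z. real_inner_prod Y (f Z) = real_inner_prod (f Y) Z)"

definition pos_def_op :: "(complex^'c^'r \<Rightarrow> complex^'c^'r) \<Rightarrow> bool" where
  "pos_def_op f \<longleftrightarrow> (\<forall>Z. Z \<noteq> 0 \<longrightarrow> 0 < real_inner_prod Z (f Z))"

text \<open>
  The eigenvalues of a real-linear operator are the complex eigenvalues of its real matrix with
  respect to a basis; the standard basis is used, whose order (chosen arbitrarily here) does not
  affect them.
\<close>

definition basis_list :: "'a::euclidean_space list" where
  "basis_list = (SOME bs. distinct bs \<and> set bs = Basis)"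

definition real_rep :: "('a::euclidean_space \<Rightarrow> 'a) \<Rightarrow> real Matrix.mat" where
  "real_rep f = Matrix.mat DIM('a) DIM('a) (\<lambda>(i, j). inner (f (basis_list ! j)) (basis_list ! i))"

definition op_spectrum :: "('a::euclidean_space \<Rightarrow> 'a) \<Rightarrow> complex set" where
  "op_spectrum f = spectrum (map_mat complex_of_real (real_rep f))"

definition op_spectral_radius :: "('a::euclidean_space \<Rightarrow> 'a) \<Rightarrow> real" where
  "op_spectral_radius f = spectral_radius (map_mat complex_of_real (real_rep f))"

text \<open>The following two are meaningful for operators all of whose eigenvalues are real.\<close>

definition max_eigenvalue :: "('a::euclidean_space \<Rightarrow> 'a) \<Rightarrow> real" where
  "max_eigenvalue f = Max {x. complex_of_real x \<in> op_spectrum f}"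

definition min_eigenvalue :: "('a::euclidean_space \<Rightarrow> 'a) \<Rightarrow> real" where
  "min_eigenvalue f = Min {x. complex_of_real x \<in> op_spectrum f}"

end

theory Submission
  imports Defs
begin

text \<open>
  Let \<open>G\<close> be the entrywise multiplication by the gaps
  \<open>\<lambda>\<^bsub>k+i\<^esub> - \<lambda>\<^sub>j + \<sigma>\<close>, which lie in \<open>[\<delta> + \<sigma>, s + \<sigma>]\<close>.  The first claim says
  \<open>\<L>\<^sub>\<sigma> = G\<inverse> \<Q> - I\<close>.  If \<open>\<L>\<^sub>\<sigma> x = z x\<close> for a complexified vector \<open>x\<close>, then
  \<open>\<Q> x = (z + 1) G x\<close>; pairing with \<open>x\<close> shows that \<open>z + 1\<close> is the quotient of the two positive
  real numbers \<open>\<langle>x, \<Q> x\<rangle>\<close> and \<open>\<langle>x, G x\<rangle>\<close>, bounded by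
  Rayleigh's principle and by the range of the gaps respectively.
\<close>

section \<open>Spectra of operators on Euclidean spaces\<close>

lemma distinct_basis_list: "distinct (basis_list :: 'a::euclidean_space list)"
  and set_basis_list: "set (basis_list :: 'a::euclidean_space list) = Basis"
proof -
  have "distinct (basis_list :: 'a list) \<and> set (basis_list :: 'a list) = Basis"
    unfolding basis_list_def
    by (rule someI_ex) (use finite_distinct_list[of "Basis :: 'a set"] in auto)
  then show "distinct (basis_list :: 'a list)" "set (basis_list :: 'a list) = Basis"
    by auto
qed

lemma length_basis_list: "length (basis_list :: 'a::euclidean_space list) = DIM('a)"
  using distinct_card[OF distinct_basis_list[where 'a = 'a]] by (simp add: set_basis_list)

lemma sum_basis_list:
  "(\<Sum>i<DIM('a). g (basis_list ! i)) = (\<Sum>b\<in>(Basis :: 'a::euclidean_space set). g b)"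
proof -
  have "bij_betw ((!) basis_list) {..<DIM('a)} (Basis :: 'a set)"
    using bij_betw_nth[OF distinct_basis_list, of "{..<DIM('a)}" "Basis :: 'a set"]
    by (simp add: length_basis_list set_basis_list)
  then show ?thesis
    by (rule sum.reindex_bij_betw)
qed

lemma basis_list_nth_mem: "i < DIM('a) \<Longrightarrow> (basis_list ! i :: 'a::euclidean_space) \<in> Basis"
  using nth_mem[of i "basis_list :: 'a list"] by (simp add: set_basis_list length_basis_list)

text \<open>Coordinates of the vector \<open>a + i b\<close> in the complexification, so that a
  complex eigenvector becomes a pair of elements of the real space.\<close>

definition complex_coords :: "'a::euclidean_space \<Rightarrow> 'a \<Rightarrow> complex Matrix.vec" where
  "complex_coords a b =
     Matrix.vec DIM('a) (\<lambda>i. Complex (inner a (basis_list ! i)) (inner b (basis_list ! i)))"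

lemma complex_coords_inject:
  "complex_coords a b = complex_coords c d \<longleftrightarrow> a = c \<and> b = (d :: 'a::euclidean_space)"
proof
  assume eq: "complex_coords a b = complex_coords c d"
  have "inner a (basis_list ! i) = inner c (basis_list ! i) \<and>
        inner b (basis_list ! i) = inner d (basis_list ! i)" if "i < DIM('a)" for i
    using arg_cong[OF eq, of "\<lambda>v. vec_index v i"] that by (simp add: complex_coords_def)
  then have "inner a e = inner c e \<and> inner b e = inner d e" if "e \<in> Basis" for e
    using that set_basis_list[where 'a = 'a] by (metis in_set_conv_nth length_basis_list)
  then show "a = c \<and> b = d"
    by (simp add: euclidean_eq_iff[of a c] euclidean_eq_iff[of b d])
qed simp

lemma complex_coords_surj:
  assumes "v \<in> carrier_vec DIM('a)"
  obtains a b :: "'a::euclidean_space" where "v = complex_coords a b"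
proof
  define comb :: "(nat \<Rightarrow> real) \<Rightarrow> 'a" where
    "comb c = (\<Sum>i<DIM('a). c i *\<^sub>R basis_list ! i)" for c
  have comb: "inner (comb c) (basis_list ! i) = c i" if i: "i < DIM('a)" for c i
  proof -
    have "inner (comb c) (basis_list ! i)
        = (\<Sum>j<DIM('a). if j = i then c j else 0)"
      unfolding comb_def inner_sum_left
    proof (rule sum.cong)
      fix j assume "j \<in> {..<DIM('a)}"
      then show "inner (c j *\<^sub>R (basis_list ! j :: 'a)) (basis_list ! i) = (if j = i then c j else 0)"
        using i distinct_basis_list[where 'a = 'a]
        by (simp add: inner_Basis basis_list_nth_mem nth_eq_iff_index_eq length_basis_list)
    qed simp
    then show ?thesis using i by simp
  qed
  show "v = complex_coords (comb (\<lambda>i. Re (vec_index v i))) (comb (\<lambda>i. Im (vec_index v i)))"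
    using assms by (intro eq_vecI) (auto simp: complex_coords_def comb)
qed

lemma real_rep_carrier:
  "map_mat complex_of_real (real_rep (f :: 'a::euclidean_space \<Rightarrow> 'a)) \<in> carrier_mat DIM('a) DIM('a)"
  by (simp add: real_rep_def)

text \<open>A real matrix acts separately on real and imaginary parts.\<close>

lemma real_rep_mult_complex_coords:
  fixes f :: "'a::euclidean_space \<Rightarrow> 'a"
  assumes "linear f"
  shows "map_mat complex_of_real (real_rep f) *\<^sub>v complex_coords a b = complex_coords (f a) (f b)"
proof (rule eq_vecI)
  fix i assume "i < dim_vec (complex_coords (f a) (f b))"
  then have i: "i < DIM('a)" by (simp add: complex_coords_def)
  have *: "(\<Sum>j<DIM('a). inner (f (basis_list ! j)) e * inner x (basis_list ! j)) = inner (f x) e"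
    for x e :: 'a
  proof -
    have "f x = f (\<Sum>b\<in>Basis. inner x b *\<^sub>R b)" by (simp add: euclidean_representation)
    also have "\<dots> = (\<Sum>b\<in>Basis. inner x b *\<^sub>R f b)"
      using assms by (simp add: linear_sum linear_cmul)
    finally have "inner (f x) e = (\<Sum>b\<in>Basis. inner (f b) e * inner x b)"
      by (simp add: inner_sum_left mult.commute)
    then show ?thesis
      using sum_basis_list[of "\<lambda>b. inner (f b) e * inner x b"] by simp
  qed
  show "vec_index (map_mat complex_of_real (real_rep f) *\<^sub>v complex_coords a b) i
      = vec_index (complex_coords (f a) (f b)) i"
    using i by (simp add: complex_coords_def real_rep_def scalar_prod_def complex_eq_iff *
        atLeast0LessThan)
qed (simp add: complex_coords_def real_rep_def)

text \<open>Splits \<open>f (a + i b) = z (a + i b)\<close> into real and imaginary parts. From here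
  on, spectra are handled by real vectors and \<open>f\<close> itself instead of complex
  matrices.\<close>

lemma op_spectrum_iff:
  fixes f :: "'a::euclidean_space \<Rightarrow> 'a"
  assumes "linear f"
  shows "z \<in> op_spectrum f \<longleftrightarrow>
    (\<exists>a b. (a \<noteq> 0 \<or> b \<noteq> 0) \<and> f a = Re z *\<^sub>R a - Im z *\<^sub>R b \<and> f b = Im z *\<^sub>R a + Re z *\<^sub>R b)"
    (is "_ = ?R")
proof -
  let ?A = "map_mat complex_of_real (real_rep f)"
  have smult: "z \<cdot>\<^sub>v complex_coords a b
      = complex_coords (Re z *\<^sub>R a - Im z *\<^sub>R b) (Im z *\<^sub>R a + Re z *\<^sub>R b)" for a b :: 'a
    by (intro eq_vecI) (auto simp: complex_coords_def complex_eq_iff inner_simps)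
  have zero: "0\<^sub>v DIM('a) = complex_coords (0 :: 'a) 0"
    by (intro eq_vecI) (auto simp: complex_coords_def complex_eq_iff)
  have dim: "dim_row ?A = DIM('a)"
    by (simp add: real_rep_def)
  have car: "complex_coords a b \<in> carrier_vec DIM('a)" for a b :: 'a
    by (simp add: complex_coords_def)
  have "z \<in> op_spectrum f \<longleftrightarrow>
      (\<exists>v. v \<in> carrier_vec DIM('a) \<and> v \<noteq> 0\<^sub>v DIM('a) \<and> ?A *\<^sub>v v = z \<cdot>\<^sub>v v)"
    unfolding op_spectrum_def spectrum_def eigenvalue_def eigenvector_def dim by simp
  also have "\<dots> \<longleftrightarrow> (\<exists>a b :: 'a. complex_coords a b \<noteq> 0\<^sub>v DIM('a) \<and>
      ?A *\<^sub>v complex_coords a b = z \<cdot>\<^sub>v complex_coords a b)"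
  proof safe
    fix v assume v: "v \<in> carrier_vec DIM('a)" "v \<noteq> 0\<^sub>v DIM('a)" "?A *\<^sub>v v = z \<cdot>\<^sub>v v"
    obtain a b :: 'a where "v = complex_coords a b"
      by (rule complex_coords_surj[OF v(1)])
    with v show "\<exists>a b :: 'a. complex_coords a b \<noteq> 0\<^sub>v DIM('a) \<and>
        ?A *\<^sub>v complex_coords a b = z \<cdot>\<^sub>v complex_coords a b"
      by blast
  qed (use car in blast)
  also have "\<dots> \<longleftrightarrow> ?R"
    by (simp add: real_rep_mult_complex_coords[OF assms] smult zero complex_coords_inject)
  finally show ?thesis .
qed

lemma finite_op_spectrum: "finite (op_spectrum f)"
  unfolding op_spectrum_def by (rule card_finite_spectrum[OF real_rep_carrier])

text \<open>A Euclidean space has positive dimension, so the spectrum is nonempty and the spectral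
  radius is attained by one of its elements.\<close>

lemma op_spectral_radius_le:
  fixes f :: "'a::euclidean_space \<Rightarrow> 'a"
  assumes "\<And>z. z \<in> op_spectrum f \<Longrightarrow> norm z \<le> r"
  shows "op_spectral_radius f \<le> r"
  using spectral_radius_mem_max(1)[OF real_rep_carrier[of f]] assms
  unfolding op_spectral_radius_def op_spectrum_def by fastforce

lemma real_eigenvalue_mem_op_spectrum:
  fixes f :: "'a::euclidean_space \<Rightarrow> 'a"
  assumes "linear f" "u \<noteq> 0" "f u = r *\<^sub>R u"
  shows "complex_of_real r \<in> op_spectrum f"
  unfolding op_spectrum_iff[OF assms(1)]
  by (rule exI[of _ u], rule exI[of _ 0]) (use assms in \<open>simp add: linear_0\<close>)

lemma finite_real_op_spectrum: "finite {x. complex_of_real x \<in> op_spectrum f}"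
  using finite_vimageI[OF finite_op_spectrum[of f], of complex_of_real]
  by (simp add: vimage_def inj_on_def)

section \<open>Symmetric operators\<close>

definition symmetric_op :: "('a::real_inner \<Rightarrow> 'a) \<Rightarrow> bool" where
  "symmetric_op f \<longleftrightarrow> (\<forall>x y. inner x (f y) = inner (f x) y)"

text \<open>Symmetry moves \<open>f\<close> onto the test vector, and the inner product is linear in
  the other argument. This is how \<open>Q_op\<close> gets its real linearity in the
  theorem.\<close>

lemma symmetric_op_linear:
  fixes f :: "'a::euclidean_space \<Rightarrow> 'a"
  assumes "symmetric_op f"
  shows "linear f"
proof (rule linearI)
  have f: "inner (f x) z = inner x (f z)" for x z
    using assms by (simp add: symmetric_op_def)
  have eqI: "x = y" if "\<And>z. inner x z = inner y z" for x y :: 'a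
    using that vector_eq_rdot[of x y] by blast
  show "f (x + y) = f x + f y" for x y
    by (rule eqI) (simp add: f inner_add_left)
  show "f (c *\<^sub>R x) = c *\<^sub>R f x" for c x
    by (rule eqI) (simp add: f)
qed

text \<open>On the line \<open>u + t g(u)\<close> the quadratic form is nonnegative and vanishes at
  \<open>t = 0\<close>, so its first-order coefficient, twice the squared norm of
  \<open>g u\<close>, must vanish.\<close>

lemma psd_op_null:
  fixes g :: "'a::euclidean_space \<Rightarrow> 'a"
  assumes sym: "symmetric_op g" and psd: "\<And>x. 0 \<le> inner x (g x)" and u: "inner u (g u) = 0"
  shows "g u = 0"
proof -
  let ?v = "g u"
  interpret linear g by (rule symmetric_op_linear[OF sym])
  define B where "B = inner ?v (g ?v)"
  have B: "B \<ge> 0" by (simp add: B_def psd)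
  have expand: "inner (u + t *\<^sub>R ?v) (g (u + t *\<^sub>R ?v)) = 2 * t * inner ?v ?v + t\<^sup>2 * B" for t
  proof -
    have "inner u (g ?v) = inner ?v ?v"
      using sym by (simp add: symmetric_op_def)
    then show ?thesis
      by (simp add: add scale inner_simps u B_def power2_eq_square algebra_simps)
  qed
  define N where "N = inner ?v ?v"
  \<comment> \<open>A negative \<open>t\<close> at which the linear term dominates; the denominator
    \<open>B + 1\<close> stays positive even if \<open>B = 0\<close>.\<close>
  define t where "t = - N / (B + 1)"
  have "0 \<le> 2 * t * N + t\<^sup>2 * B"
    using psd[of "u + t *\<^sub>R ?v"] unfolding expand N_def .
  also have "\<dots> = - (N\<^sup>2 * (B + 2)) / (B + 1)\<^sup>2"
    using B unfolding t_def by (simp add: divide_simps) (simp add: power2_eq_square algebra_simps)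
  finally have "N\<^sup>2 * (B + 2) \<le> 0"
    using B by (simp add: field_simps zero_le_divide_iff)
  then have "N = 0"
    using B by (simp add: mult_le_0_iff)
  then show ?thesis
    by (simp add: N_def)
qed

text \<open>The quadratic form attains its maximum \<open>r\<close> over the compact unit sphere at
  some \<open>u\<close>. Then \<open>r I - f\<close> is positive semidefinite and its form vanishes
  at \<open>u\<close>, so \<open>psd_op_null\<close> makes \<open>u\<close> an eigenvector.\<close>

lemma rayleigh_maximizer:
  fixes f :: "'a::euclidean_space \<Rightarrow> 'a"
  assumes sym: "symmetric_op f"
  shows "\<exists>u r. u \<noteq> 0 \<and> f u = r *\<^sub>R u \<and> (\<forall>x. inner x (f x) \<le> r * inner x x)"
proof -
  interpret linear f by (rule symmetric_op_linear[OF sym])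
  have "bounded_linear f"
    by (simp add: linear_axioms linear_linear)
  then have cont: "continuous_on (sphere 0 1) (\<lambda>x. inner x (f x))"
    by (intro continuous_intros linear_continuous_on)
  obtain e :: 'a where "e \<in> Basis" using nonempty_Basis by blast
  then have "sphere (0 :: 'a) 1 \<noteq> {}" by (force simp: dist_norm)
  from continuous_attains_sup[OF compact_sphere this cont]
  obtain u where u: "norm u = 1" and max: "\<And>x. norm x = 1 \<Longrightarrow> inner x (f x) \<le> inner u (f u)"
    by (auto simp: dist_norm)
  define r where "r = inner u (f u)"
  have bound: "inner x (f x) \<le> r * inner x x" for x
  proof (cases "x = 0")
    case False
    let ?y = "inverse (norm x) *\<^sub>R x"
    have "inner ?y (f ?y) \<le> r"
      unfolding r_def by (rule max) (use False in simp)
    then show ?thesis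
      using False by (simp add: scale dot_square_norm field_simps power2_eq_square)
  qed simp
  let ?g = "\<lambda>x. r *\<^sub>R x - f x"
  have "symmetric_op ?g"
    using sym by (simp add: symmetric_op_def inner_diff_left inner_diff_right)
  moreover have "0 \<le> inner x (?g x)" for x
    using bound by (simp add: inner_diff_right)
  moreover have "inner u (?g u) = 0"
    using u by (simp add: inner_diff_right r_def dot_square_norm)
  ultimately have "?g u = 0"
    by (rule psd_op_null)
  then have "f u = r *\<^sub>R u" and "u \<noteq> 0"
    using u by auto
  with bound show ?thesis by blast
qed

lemma inner_op_le_max_eigenvalue:
  fixes f :: "'a::euclidean_space \<Rightarrow> 'a"
  assumes "symmetric_op f"
  shows "inner x (f x) \<le> max_eigenvalue f * inner x x"
proof -
  obtain u r where u: "u \<noteq> 0" "f u = r *\<^sub>R u" and r: "\<And>x. inner x (f x) \<le> r * inner x x"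
    using rayleigh_maximizer[OF assms] by blast
  have "r \<le> max_eigenvalue f"
    unfolding max_eigenvalue_def
    by (rule Max_ge[OF finite_real_op_spectrum])
      (simp add: real_eigenvalue_mem_op_spectrum[OF symmetric_op_linear[OF assms] u])
  then have "r * inner x x \<le> max_eigenvalue f * inner x x"
    by (simp add: mult_right_mono)
  with r[of x] show ?thesis by linarith
qed

lemma min_eigenvalue_le_inner_op:
  fixes f :: "'a::euclidean_space \<Rightarrow> 'a"
  assumes "symmetric_op f"
  shows "min_eigenvalue f * inner x x \<le> inner x (f x)"
proof -
  \<comment> \<open>The Rayleigh maximum \<open>r\<close> of \<open>- f\<close> is the negative of
    the Rayleigh minimum of \<open>f\<close>, so \<open>- r\<close> is an eigenvalue of
    \<open>f\<close>.\<close>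
  have "symmetric_op (\<lambda>x. - f x)"
    using assms by (simp add: symmetric_op_def)
  from rayleigh_maximizer[OF this] obtain u r where u: "u \<noteq> 0" "- f u = r *\<^sub>R u"
    and r: "\<And>x. inner x (- f x) \<le> r * inner x x"
    by blast
  have "f u = - (r *\<^sub>R u)"
    using u(2) by (metis minus_minus)
  then have fu: "f u = (- r) *\<^sub>R u"
    by simp
  have "min_eigenvalue f \<le> - r"
    unfolding min_eigenvalue_def
    by (rule Min_le[OF finite_real_op_spectrum], rule CollectI)
      (rule real_eigenvalue_mem_op_spectrum[OF symmetric_op_linear[OF assms] u(1) fu])
  then have "min_eigenvalue f * inner x x \<le> - r * inner x x"
    by (rule mult_right_mono) simp
  with r[of x] show ?thesis by simp
qed

text \<open>\<open>Max\<close> and \<open>Min\<close> range over a finite set, which is nonempty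
  because a Rayleigh maximizer yields a real eigenvalue.\<close>

lemma max_min_eigenvalue_mem_op_spectrum:
  fixes f :: "'a::euclidean_space \<Rightarrow> 'a"
  assumes "symmetric_op f"
  shows "complex_of_real (max_eigenvalue f) \<in> op_spectrum f"
    and "complex_of_real (min_eigenvalue f) \<in> op_spectrum f"
proof -
  obtain u r where "u \<noteq> 0" "f u = r *\<^sub>R u"
    using rayleigh_maximizer[OF assms] by blast
  then have "{x. complex_of_real x \<in> op_spectrum f} \<noteq> {}"
    using real_eigenvalue_mem_op_spectrum[OF symmetric_op_linear[OF assms]] by blast
  from Max_in[OF finite_real_op_spectrum this] Min_in[OF finite_real_op_spectrum this]
  show "complex_of_real (max_eigenvalue f) \<in> op_spectrum f"
    "complex_of_real (min_eigenvalue f) \<in> op_spectrum f"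
    by (simp_all add: max_eigenvalue_def min_eigenvalue_def)
qed

lemma min_eigenvalue_le_max_eigenvalue:
  assumes "symmetric_op f"
  shows "min_eigenvalue f \<le> max_eigenvalue f"
  unfolding max_eigenvalue_def
  by (rule Max_ge) (simp_all add: finite_real_op_spectrum max_min_eigenvalue_mem_op_spectrum[OF assms])

text \<open>The pencil is written in real coordinates: the eigenvector is \<open>a + i b\<close>, the eigenvalue \<open>p + i q\<close>.\<close>

lemma symmetric_pencil_eigenvalue:
  fixes f G :: "'a::euclidean_space \<Rightarrow> 'a"
  assumes f: "symmetric_op f" and G: "symmetric_op G"
    and fa: "f a = p *\<^sub>R G a - q *\<^sub>R G b" and fb: "f b = q *\<^sub>R G a + p *\<^sub>R G b"
    and pos: "inner a (G a) + inner b (G b) > 0"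
  shows "q = 0" and "inner a (f a) + inner b (f b) = p * (inner a (G a) + inner b (G b))"
proof -
  have sym_G: "inner b (G a) = inner a (G b)"
    by (metis G symmetric_op_def inner_commute)
  \<comment> \<open>After substituting \<open>fa\<close> and \<open>fb\<close>, the terms with
    \<open>p\<close> cancel by symmetry of \<open>G\<close>, leaving \<open>q\<close> times the
    positive sum in \<open>pos\<close>.\<close>
  have "inner b (f a) = inner a (f b)"
    by (metis f symmetric_op_def inner_commute)
  then have "q * (inner a (G a) + inner b (G b)) = 0"
    unfolding fa fb by (simp add: inner_simps sym_G algebra_simps)
  with pos show "q = 0" by simp
  then show "inner a (f a) + inner b (f b) = p * (inner a (G a) + inner b (G b))"
    unfolding fa fb by (simp add: inner_simps algebra_simps)
qed

text \<open>The pencil argument with the identity in place of \<open>G\<close>.\<close>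

lemma symmetric_op_spectrum_real:
  fixes f :: "'a::euclidean_space \<Rightarrow> 'a"
  assumes f: "symmetric_op f"
  shows "op_spectrum f \<subseteq> \<real>"
proof
  fix z assume "z \<in> op_spectrum f"
  then obtain a b where ab: "a \<noteq> 0 \<or> b \<noteq> 0"
    and "f a = Re z *\<^sub>R a - Im z *\<^sub>R b" "f b = Im z *\<^sub>R a + Re z *\<^sub>R b"
    unfolding op_spectrum_iff[OF symmetric_op_linear[OF f]] by blast
  moreover have "inner a a + inner b b > 0"
    using ab by (metis add.commute add_nonneg_pos add_pos_nonneg inner_ge_zero inner_gt_zero_iff)
  moreover have "symmetric_op (\<lambda>x :: 'a. x)"
    by (simp add: symmetric_op_def)
  ultimately have "Im z = 0"
    using symmetric_pencil_eigenvalue(1)[OF f, of "\<lambda>x. x" a "Re z" "Im z" b] by simp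
  then show "z \<in> \<real>"
    by (simp add: complex_is_Real_iff)
qed

text \<open>The eigenvalue is real, so each nonzero part of a complex eigenvector is itself a real
  eigenvector, on which the form is positive.\<close>

lemma min_eigenvalue_pos:
  fixes f :: "'a::euclidean_space \<Rightarrow> 'a"
  assumes f: "symmetric_op f" and pos: "\<And>x. x \<noteq> 0 \<Longrightarrow> 0 < inner x (f x)"
  shows "0 < min_eigenvalue f"
proof -
  let ?m = "min_eigenvalue f"
  obtain a b where "a \<noteq> 0 \<or> b \<noteq> 0" "f a = ?m *\<^sub>R a" "f b = ?m *\<^sub>R b"
    using max_min_eigenvalue_mem_op_spectrum(2)[OF f]
    unfolding op_spectrum_iff[OF symmetric_op_linear[OF f]] by auto
  then show ?thesis
    using pos[of a] pos[of b] by (auto simp: zero_less_mult_iff) (metis inner_ge_zero leD)+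
qed

text \<open>\<open>Gg\<close> is the relation \<open>g = G\<^sup>-\<^sup>1 f - I\<close> with the
  inverse cleared. In the application \<open>G\<close> multiplies by the gaps, \<open>f\<close> is
  \<open>Q_op\<close> and \<open>g\<close> is \<open>L_op\<close>.\<close>

lemma preconditioned_spectral_radius_le:
  fixes f G g :: "'a::euclidean_space \<Rightarrow> 'a"
  assumes f: "symmetric_op f" and f_pos: "\<And>x. x \<noteq> 0 \<Longrightarrow> 0 < inner x (f x)"
    and G: "symmetric_op G" and g: "linear g" and Gg: "\<And>x. G (g x) = f x - G x"
    and \<alpha>: "0 < \<alpha>" and lower: "\<And>x. \<alpha> * inner x x \<le> inner x (G x)"
    and upper: "\<And>x. inner x (G x) \<le> \<beta> * inner x x"
  shows "op_spectral_radius g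
    \<le> max \<bar>max_eigenvalue f / \<alpha> - 1\<bar> \<bar>min_eigenvalue f / \<beta> - 1\<bar>"
proof (rule op_spectral_radius_le)
  fix z assume "z \<in> op_spectrum g"
  then obtain a b where ab: "a \<noteq> 0 \<or> b \<noteq> 0"
    and ga: "g a = Re z *\<^sub>R a - Im z *\<^sub>R b" and gb: "g b = Im z *\<^sub>R a + Re z *\<^sub>R b"
    unfolding op_spectrum_iff[OF g] by blast
  interpret G: linear G by (rule symmetric_op_linear[OF G])
  \<comment> \<open>\<open>S\<close>, \<open>T\<close> and \<open>R\<close> are the Hermitian forms
    of the identity, \<open>G\<close> and \<open>f\<close> at \<open>a + i b\<close>; the cross
    terms cancel by symmetry.\<close>
  define S where "S = inner a a + inner b b"
  define T where "T = inner a (G a) + inner b (G b)"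
  define R where "R = inner a (f a) + inner b (f b)"
  have S: "S > 0"
    using ab unfolding S_def
    by (metis add.commute add_nonneg_pos add_pos_nonneg inner_ge_zero inner_gt_zero_iff)
  have T: "\<alpha> * S \<le> T" "T \<le> \<beta> * S"
    using lower[of a] lower[of b] upper[of a] upper[of b]
    by (simp_all add: S_def T_def algebra_simps)
  have R: "min_eigenvalue f * S \<le> R" "R \<le> max_eigenvalue f * S"
    using min_eigenvalue_le_inner_op[OF f, of a] min_eigenvalue_le_inner_op[OF f, of b]
      inner_op_le_max_eigenvalue[OF f, of a] inner_op_le_max_eigenvalue[OF f, of b]
    by (simp_all add: S_def R_def algebra_simps)
  have \<alpha>S: "0 < \<alpha> * S" using \<alpha> S by simp
  then have T_pos: "0 < T" using T by linarith
  have \<beta>: "0 < \<beta>"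
    using T(2) T_pos S by (metis less_le_trans zero_less_mult_pos2)
  have "f a = (Re z + 1) *\<^sub>R G a - Im z *\<^sub>R G b"
    using Gg[of a] unfolding ga by (simp add: G.diff G.scale algebra_simps)
  moreover have "f b = Im z *\<^sub>R G a + (Re z + 1) *\<^sub>R G b"
    using Gg[of b] unfolding gb by (simp add: G.add G.scale algebra_simps)
  ultimately have "Im z = 0" and "R = (Re z + 1) * T"
    using symmetric_pencil_eigenvalue[OF f G] T_pos unfolding R_def T_def by blast+
  then have z: "Re z = R / T - 1" and norm_z: "norm z = \<bar>Re z\<bar>"
    using T_pos by (simp_all add: norm_complex_def field_simps)
  have m: "0 < min_eigenvalue f" by (rule min_eigenvalue_pos[OF f f_pos])
  \<comment> \<open>With a positive numerator, the quotient \<open>R / T\<close> grows when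
    \<open>R\<close> grows or \<open>T\<close> shrinks, as both uses of \<open>frac_le\<close> below
    require.\<close>
  have R_pos: "0 < R" using R(1) m S by (meson less_le_trans mult_pos_pos)
  have "R / T \<le> (max_eigenvalue f * S) / (\<alpha> * S)"
    by (rule frac_le) (use R R_pos \<alpha>S T in auto)
  moreover have "(min_eigenvalue f * S) / (\<beta> * S) \<le> R / T"
    by (rule frac_le) (use R R_pos T T_pos in auto)
  ultimately have "R / T \<le> max_eigenvalue f / \<alpha>" "min_eigenvalue f / \<beta> \<le> R / T"
    using S by simp_all
  \<comment> \<open>The distance to 1 over an interval is largest at an endpoint.\<close>
  then show "norm z \<le> max \<bar>max_eigenvalue f / \<alpha> - 1\<bar> \<bar>min_eigenvalue f / \<beta> - 1\<bar>"
    unfolding norm_z z by linarith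
qed

section \<open>Ordered eigenvalues and entrywise products\<close>

lemma pos_bounds: "1 \<le> pos (i :: 'i::{finite,linorder})" "pos i \<le> CARD('i)"
proof -
  have "card {i} \<le> card {..i}" "card {..i} \<le> CARD('i)"
    by (rule card_mono; auto)+
  then show "1 \<le> pos i" "pos i \<le> CARD('i)"
    by (simp_all add: pos_def)
qed

text \<open>The characteristic polynomial has as many complex roots, with multiplicity, as its
  degree. The sorted list thus has \<open>CARD('n)\<close> entries, and the shifted index
  \<open>j - 1\<close> falls inside it.\<close>

lemma lam_mono:
  fixes A :: "('n::{finite,linorder}, 'n) cmat"
  assumes "1 \<le> i" "i \<le> j" "j \<le> CARD('n)"
  shows "lam A i \<le> lam A j"
proof -
  have "to_mat A \<in> carrier_mat CARD('n) CARD('n)"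
    by (simp add: to_mat_def)
  then have "size (eigvals_mset A) = CARD('n)"
    by (simp add: eigvals_mset_def size_proots_complex degree_monic_char_poly)
  then have "length (sorted_list_of_multiset (image_mset Re (eigvals_mset A))) = CARD('n)"
    by (metis mset_sorted_list_of_multiset size_mset size_image_mset)
  then show ?thesis
    unfolding lam_def using assms by (intro sorted_nth_mono) auto
qed

text \<open>Identifies the trace inner product with the Euclidean one, so that the results on
  \<open>symmetric_op\<close> apply to matrix operators.\<close>

lemma real_inner_prod_eq_inner: "real_inner_prod X Y = inner X Y"
proof -
  have "real_inner_prod X Y = (\<Sum>j\<in>UNIV. \<Sum>i\<in>UNIV. inner (X $ i $ j) (Y $ i $ j))"
    by (simp add: real_inner_prod_def Determinants.trace_def ctrans_def matrix_matrix_mult_def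
        inner_complex_def)
  also have "\<dots> = inner X Y"
    unfolding inner_vec_def by (rule sum.swap)
  finally show ?thesis .
qed

lemma inner_hadamard:
  "inner X (hadamard D Y) = (\<Sum>i\<in>UNIV. \<Sum>j\<in>UNIV. D $ i $ j * inner (X $ i $ j) (Y $ i $ j))"
  by (simp add: inner_vec_def hadamard_def inner_complex_def algebra_simps)

lemma symmetric_op_hadamard: "symmetric_op (hadamard D)"
  unfolding symmetric_op_def inner_commute[of "hadamard D _"] inner_hadamard
  by (simp add: inner_commute)

lemma inner_hadamard_mono:
  assumes "\<And>i j. D $ i $ j \<le> E $ i $ j"
  shows "inner X (hadamard D X) \<le> inner X (hadamard E X)"
  unfolding inner_hadamard by (intro sum_mono mult_right_mono assms) simp

text \<open>Lets \<open>inner_hadamard_mono\<close> turn uniform bounds on the entries into bounds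
  by multiples of the squared norm.\<close>

lemma inner_hadamard_const: "inner X (hadamard (\<chi> i j. c) X) = c * inner X X"
  unfolding inner_hadamard by (simp add: inner_vec_def sum_distrib_left)

lemma hadamard_cancel:
  assumes "\<And>i j. D $ i $ j * E $ i $ j = 1"
  shows "hadamard D (hadamard E Z) = Z"
proof -
  have "complex_of_real (D $ i $ j) * (complex_of_real (E $ i $ j) * z) = z" for i j z
    using assms[of i j] by (metis mult.assoc mult_1 of_real_1 of_real_mult)
  then show ?thesis
    by (simp add: Finite_Cartesian_Product.vec_eq_iff hadamard_def)
qed

section \<open>Derivative of the level-shifted matrix\<close>

text \<open>Level one of \<open>k_smooth\<close> makes each entry differentiable, and every real
  coordinate of \<open>H\<close> is the inner product of an entry with a fixed complex
  number.\<close>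

lemma mat_differentiable_imp_differentiable:
  fixes H :: "complex^'k^'n \<Rightarrow> complex^'n^'n"
  assumes "mat_differentiable H"
  shows "H differentiable (at V)"
proof -
  have entry: "(\<lambda>V. H V $ i $ j) differentiable (at V)" for i j
  proof -
    have "k_smooth (Suc 0) (\<lambda>V. H V $ i $ j)"
      using assms by (simp only: mat_differentiable_def smooth_def)
    then show ?thesis by simp
  qed
  show ?thesis
  proof (subst differentiable_componentwise_within, intro ballI)
    fix b :: "complex^'n^'n" assume "b \<in> Basis"
    then obtain i j u where b: "b = axis i (axis j u)"
      by (auto simp: Basis_vec_def)
    show "(\<lambda>V. inner (H V) b) differentiable (at V)"
      unfolding b inner_axis
      using differentiable_inner[OF entry[of i j] differentiable_const[of u]] by simp
  qed
qed

lemma bounded_bilinear_cmat_mult: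
  "bounded_bilinear ((**) :: complex^'b^'a \<Rightarrow> complex^'c^'b \<Rightarrow> complex^'c^'a)"
proof -
  have "bilinear ((**) :: complex^'b^'a \<Rightarrow> complex^'c^'b \<Rightarrow> complex^'c^'a)"
    unfolding bilinear_def
    by (auto intro!: linearI simp: Finite_Cartesian_Product.vec_eq_iff
        matrix_matrix_mult_def algebra_simps sum.distrib scaleR_sum_right)
  then show ?thesis
    by (simp add: bilinear_conv_bounded_bilinear)
qed

text \<open>Conjugation is linear over the reals, which matches the real parameter in
  \<open>dir_deriv\<close>.\<close>

lemma bounded_linear_ctrans: "bounded_linear (ctrans :: complex^'c^'r \<Rightarrow> complex^'r^'c)"
proof -
  have "linear (ctrans :: complex^'c^'r \<Rightarrow> complex^'r^'c)"
    by (rule linearI) (simp_all add: Finite_Cartesian_Product.vec_eq_iff ctrans_def)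
  then show ?thesis by (simp add: linear_linear)
qed

text \<open>The product rule for \<open>V ** ctrans V\<close> along the line through
  \<open>V\<close> in direction \<open>X\<close>.\<close>

lemma dir_deriv_level_shift:
  assumes "mat_differentiable H"
  shows "dir_deriv (level_shift \<sigma> H) V X
    = dir_deriv H V X - \<sigma> *\<^sub>R (V ** ctrans X + X ** ctrans V)"
proof -
  have line: "((\<lambda>t. V + t *\<^sub>R X) has_vector_derivative X) (at (0::real))"
    by (auto intro!: derivative_eq_intros)
  obtain H' where "(H has_derivative H') (at V)"
    using mat_differentiable_imp_differentiable[OF assms] unfolding differentiable_def by blast
  then have "((\<lambda>t. H (V + t *\<^sub>R X)) has_vector_derivative H' X) (at (0::real))"
    using vector_derivative_diff_chain_within[OF line, of H H'] has_derivative_at_withinI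
    by (auto simp: o_def)
  \<comment> \<open>\<open>vector_derivative\<close> is a choice operator; existence of the
    derivative is what makes \<open>dir_deriv H V X\<close> the actual derivative.\<close>
  then have H: "((\<lambda>t. H (V + t *\<^sub>R X)) has_vector_derivative dir_deriv H V X) (at (0::real))"
    unfolding dir_deriv_def by (simp add: vector_derivative_at)
  have "((\<lambda>t. (V + t *\<^sub>R X) ** ctrans (V + t *\<^sub>R X)) has_vector_derivative
      V ** ctrans X + X ** ctrans V) (at (0::real))"
    using bounded_bilinear.has_vector_derivative[OF bounded_bilinear_cmat_mult line
        bounded_linear.has_vector_derivative[OF bounded_linear_ctrans line]]
    by simp
  then have "((\<lambda>t. \<sigma> *\<^sub>R ((V + t *\<^sub>R X) ** ctrans (V + t *\<^sub>R X))) has_vector_derivative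
      \<sigma> *\<^sub>R (V ** ctrans X + X ** ctrans V)) (at (0::real))"
    by (rule bounded_linear.has_vector_derivative[OF bounded_linear_scaleR_right])
  then show ?thesis
    unfolding dir_deriv_def[of "level_shift \<sigma> H"] level_shift_def
    by (intro vector_derivative_at has_vector_derivative_diff H)
qed

text \<open>The Gram matrix of \<open>[V, W]\<close> is the identity; its blocks are read off by the
  constructors \<open>Inl\<close> and \<open>Inr\<close>.\<close>

lemma unitary_hcat_blocks:
  assumes "unitary (hcat V W)"
  shows "ctrans V ** V = Finite_Cartesian_Product.mat 1"
    and "ctrans W ** W = Finite_Cartesian_Product.mat 1"
    and "ctrans W ** V = 0"
proof -
  have "(ctrans (hcat V W) ** hcat V W) $ s $ t = Finite_Cartesian_Product.mat 1 $ s $ t" for s t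
    using assms by (simp add: unitary_def)
  note eq = this[of "Inl _" "Inl _"] this[of "Inr _" "Inr _"] this[of "Inr _" "Inl _"]
  show "ctrans V ** V = Finite_Cartesian_Product.mat 1"
    "ctrans W ** W = Finite_Cartesian_Product.mat 1" "ctrans W ** V = 0"
    using eq unfolding Finite_Cartesian_Product.vec_eq_iff
    by (simp_all add: matrix_matrix_mult_def ctrans_def hcat_def Finite_Cartesian_Product.mat_def)
qed

text \<open>The term \<open>V (W Z)\<^sup>H V\<close> of the product rule drops out because \<open>W\<^sup>H V = 0\<close>.\<close>

lemma projected_dir_deriv_level_shift:
  fixes H :: "complex^'k^'n \<Rightarrow> complex^'n^'n" and Z :: "complex^'k^'m"
  assumes "mat_differentiable H" and U: "unitary (hcat V W)"
  shows "ctrans W ** dir_deriv (level_shift \<sigma> H) V (W ** Z) ** V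
    = ctrans W ** dir_deriv H V (W ** Z) ** V - \<sigma> *\<^sub>R Z"
proof -
  interpret l: bounded_bilinear "(**) :: complex^'n^'m \<Rightarrow> complex^'n^'n \<Rightarrow> complex^'n^'m"
    by (rule bounded_bilinear_cmat_mult)
  interpret r: bounded_bilinear "(**) :: complex^'n^'m \<Rightarrow> complex^'k^'n \<Rightarrow> complex^'k^'m"
    by (rule bounded_bilinear_cmat_mult)
  note UVW = unitary_hcat_blocks[OF U]
  have "ctrans W ** (V ** ctrans (W ** Z)) = 0"
    by (simp add: matrix_mul_assoc UVW)
  moreover have "ctrans W ** (W ** Z ** ctrans V) ** V = Z"
  proof -
    have "ctrans W ** (W ** Z ** ctrans V) ** V = (ctrans W ** W) ** Z ** (ctrans V ** V)"
      by (simp only: matrix_mul_assoc)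
    then show ?thesis by (simp add: UVW)
  qed
  ultimately show ?thesis
    by (simp add: dir_deriv_level_shift[OF assms(1)] l.diff_right l.add_right l.scaleR_right
        r.diff_left r.add_left r.scaleR_left)
qed

section \<open>The operator identity and the spectral radius bound for the level-shifted SCF\<close>

theorem theorem2:
  fixes H :: "('n::{finite,linorder}, 'k::{finite,linorder}) cmat \<Rightarrow> ('n, 'n) cmat"
    and V :: "('n, 'k) cmat"
    and W :: "('n, 'm::{finite,linorder}) cmat"
    and \<sigma> \<delta> s \<mu>max \<mu>min :: real
  assumes dims: "CARD('n) = CARD('k) + CARD('m)"
    and H_continuous: "continuous_on UNIV H"
    and H_hermitian: "\<And>X. hermitian (H X)"
    and H_invariant: "\<And>X (P :: ('k, 'k) cmat). unitary P \<Longrightarrow> H (X ** P) = H X"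
    and H_differentiable: "mat_differentiable H"
    and solution: "nepv_solution H V"
    and basis_unitary: "unitary (hcat V W)"
    and eigendecomposition:
      "H V ** hcat V W = hcat V W ** block_diag (Lam H V) (Lam_perp H V)"
    and \<delta>_def: "\<delta> = lam (H V) (CARD('k) + 1) - lam (H V) CARD('k)"
    and \<delta>_pos: "\<delta> > 0"
    and Q_self_adjoint: "self_adjoint_op (Q_op H V W)"
    and Q_pos_def: "pos_def_op (Q_op H V W)"
    and \<sigma>_range: "\<sigma> > - \<delta>"
    and s_def: "s = lam (H V) CARD('n) - lam (H V) 1"
    and \<mu>max_def: "\<mu>max = max_eigenvalue (Q_op H V W)"
    and \<mu>min_def: "\<mu>min = min_eigenvalue (Q_op H V W)"
  shows "L_op H V W \<sigma> = (\<lambda>Z. hadamard (D_sigma H V \<sigma>) (Q_op H V W Z) - Z)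
    \<and> op_spectrum (Q_op H V W) \<subseteq> \<real> \<and> \<mu>max \<ge> \<mu>min \<and> \<mu>min > 0
    \<and> op_spectral_radius (L_op H V W \<sigma>)
        \<le> max \<bar>\<mu>max / (\<sigma> + \<delta>) - 1\<bar> \<bar>\<mu>min / (\<sigma> + s) - 1\<bar>"
proof -
  let ?gap = "\<lambda>(i :: 'm) (j :: 'k). lam (H V) (CARD('k) + pos i) - lam (H V) (pos j) + \<sigma>"
  define G :: "('m, 'k) rmat" where "G = (\<chi> i j. ?gap i j)"
  \<comment> \<open>The index \<open>CARD('k) + pos i\<close> runs from \<open>k + 1\<close> to
    \<open>n\<close> and \<open>pos j\<close> from \<open>1\<close> to \<open>k\<close>, so the
    ordering of eigenvalues puts every gap between these extremes.\<close>
  have gap: "\<sigma> + \<delta> \<le> ?gap i j" "?gap i j \<le> \<sigma> + s" for i j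
  proof -
    note ij = pos_bounds[of i] pos_bounds[of j]
    have "lam (H V) (CARD('k) + 1) \<le> lam (H V) (CARD('k) + pos i)"
      "lam (H V) (pos j) \<le> lam (H V) CARD('k)"
      "lam (H V) (CARD('k) + pos i) \<le> lam (H V) CARD('n)"
      "lam (H V) 1 \<le> lam (H V) (pos j)"
      by (rule lam_mono; use ij dims in linarith)+
    then show "\<sigma> + \<delta> \<le> ?gap i j" "?gap i j \<le> \<sigma> + s"
      unfolding \<delta>_def s_def by linarith+
  qed
  \<comment> \<open>No gap is zero, so the entries of \<open>D_sigma\<close> are genuine reciprocals
    and not the default \<open>inverse 0 = 0\<close>.\<close>
  have gap_pos: "0 < ?gap i j" for i j
    using gap(1)[of i j] \<sigma>_range by linarith
  have D_G: "hadamard (D_sigma H V \<sigma>) (hadamard G Z) = Z"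
    and G_D: "hadamard G (hadamard (D_sigma H V \<sigma>) Z) = Z" for Z
    using gap_pos by (auto intro!: hadamard_cancel simp: D_sigma_def G_def less_imp_neq[symmetric])
  interpret D: linear "hadamard (D_sigma H V \<sigma>)"
    by (rule symmetric_op_linear[OF symmetric_op_hadamard])
  interpret G: linear "hadamard G"
    by (rule symmetric_op_linear[OF symmetric_op_hadamard])
  \<comment> \<open>Both factors are diagonal, so the Sylvester part of \<open>Q_op\<close> acts
    entrywise; adding the shift produces exactly the gaps.\<close>
  have shift: "Lam_perp H V ** Z - Z ** Lam H V + \<sigma> *\<^sub>R Z = hadamard G Z" for Z
  proof -
    have "(Lam_perp H V ** Z) $ i $ j = complex_of_real (lam (H V) (CARD('k) + pos i)) * Z $ i $ j"
      "(Z ** Lam H V) $ i $ j = Z $ i $ j * complex_of_real (lam (H V) (pos j))" for i j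
      by (simp_all add: matrix_matrix_mult_def Lam_perp_def Lam_def if_distrib if_distribR
          cong: if_cong)
    then show ?thesis
      by (simp add: Finite_Cartesian_Product.vec_eq_iff hadamard_def G_def
          scaleR_conv_of_real[where 'a = complex] algebra_simps)
  qed
  have L: "L_op H V W \<sigma> Z = hadamard (D_sigma H V \<sigma>) (Q_op H V W Z) - Z" for Z
  proof -
    \<comment> \<open>The level shift contributes \<open>- \<sigma> Z\<close>. Adding and
      subtracting the Sylvester part completes the first term to \<open>Q_op\<close>, and
      \<open>shift\<close> collects the rest.\<close>
    have "ctrans W ** dir_deriv (level_shift \<sigma> H) V (W ** Z) ** V
        = Q_op H V W Z - hadamard G Z"
      unfolding projected_dir_deriv_level_shift[OF H_differentiable basis_unitary] Q_op_def
        shift[symmetric] by simp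
    then show ?thesis
      by (simp add: L_op_def D.diff D_G)
  qed
  have Q: "symmetric_op (Q_op H V W)"
    using Q_self_adjoint
    by (simp add: symmetric_op_def self_adjoint_op_def real_inner_prod_eq_inner)
  have Q_pos: "0 < inner Z (Q_op H V W Z)" if "Z \<noteq> 0" for Z
    using Q_pos_def that by (simp add: pos_def_op_def real_inner_prod_eq_inner)
  have L_eq: "L_op H V W \<sigma> = (\<lambda>Z. hadamard (D_sigma H V \<sigma>) (Q_op H V W Z) - Z)"
    using L by blast
  have "linear (L_op H V W \<sigma>)"
    using linear_compose_sub[OF linear_compose[OF symmetric_op_linear[OF Q] D.linear_axioms]
        linear_ident]
    by (simp add: L_eq o_def)
  \<comment> \<open>Multiplying by the gaps undoes \<open>D_sigma\<close>, giving the form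
    \<open>Gg\<close> of the preconditioned bound.\<close>
  moreover have "hadamard G (L_op H V W \<sigma> Z) = Q_op H V W Z - hadamard G Z" for Z
    by (simp add: L G.diff G_D)
  moreover have "0 < \<sigma> + \<delta>"
    using \<sigma>_range by simp
  moreover have "(\<sigma> + \<delta>) * inner Z Z \<le> inner Z (hadamard G Z)"
    "inner Z (hadamard G Z) \<le> (\<sigma> + s) * inner Z Z" for Z
    \<comment> \<open>Each scalar bound is rewritten as the form of a constant matrix, to be
      compared with \<open>G\<close> entry by entry.\<close>
    unfolding inner_hadamard_const[symmetric]
    by (rule inner_hadamard_mono; simp add: G_def gap)+
  ultimately have "op_spectral_radius (L_op H V W \<sigma>)
      \<le> max \<bar>\<mu>max / (\<sigma> + \<delta>) - 1\<bar> \<bar>\<mu>min / (\<sigma> + s) - 1\<bar>"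
    unfolding \<mu>max_def \<mu>min_def
    by (intro preconditioned_spectral_radius_le[OF Q Q_pos symmetric_op_hadamard[of G]])
  moreover have "\<mu>max \<ge> \<mu>min" "\<mu>min > 0"
    unfolding \<mu>max_def \<mu>min_def
    using min_eigenvalue_le_max_eigenvalue[OF Q] min_eigenvalue_pos[OF Q Q_pos] by auto
  ultimately show ?thesis
    using symmetric_op_spectrum_real[OF Q] L_eq by blast
qed

end
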